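(* Let $\Gamma$ be the $3$-regular tree with graph distance $d$, and let $\lambda$ be in the interior of $\Sigma=[3-2\sqrt2,3+2\sqrt2]$. Let $$b(\lambda)=8\,\frac{-\lambda^2+6\lambda}{-\lambda^2+6\lambda-1},\qquad P_\lambda f(x)=\sum_{y\in\Gamma}\varphi_{\frac12+it}(d(x,y))f(y),$$ where $\lambda=3-2\sqrt2\cos(t\log2)$, $0<t<\frac{\pi}{\log2}$. Suppose $f:\Gamma\to\mathbb C$ has finite support. Then $$\langle P_\lambda f,f\rangle=12\,b(\lambda)^{-1}\langle P_\lambda f,P_\lambda f\rangle_M ,$$ where $\langle\cdot,\cdot\rangle_M$ is the modified mean inner product $$\langle f,g\rangle_M=\lim_{N\to\infty}\frac1N\sum_{d(x,x_0)\le N}f(x)\overline{g(x)}$$ (for the functions in question the limit exists and is independent of the base point $x_0\in\Gamma$).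
   Context: $\langle f,g\rangle=\sum_{x\in\Gamma}f(x)\overline{g(x)}$ (sum over vertices). For $z\in\mathbb C$ with $2^{2z-1}\neq1$, $c(z)=\frac13\,\frac{2^{1-z}-2^{z-1}}{2^{-z}-2^{z-1}}$ and $\varphi_z(n)=c(z)2^{-nz}+c(1-z)2^{-n(1-z)}$. One has $b(\lambda)=8+\frac1{\sin^2(t\log2)}$. *)

theory Defs
  imports "HOL-Analysis.Analysis"
begin

text \<open>A graph is given by its adjacency relation; its vertices are all the elements of the
  type \<open>'v\<close>.\<close>

definition simple_graph :: "('v \<Rightarrow> 'v \<Rightarrow> bool) \<Rightarrow> bool" where
  "simple_graph E \<longleftrightarrow> symp E \<and> irreflp E"

definition connected_graph :: "('v \<Rightarrow> 'v \<Rightarrow> bool) \<Rightarrow> bool" where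
  "connected_graph E \<longleftrightarrow> (\<forall>x y. E\<^sup>*\<^sup>* x y)"

text \<open>A cycle is the list of its vertices; the closing edge joins the last one to the first.\<close>

definition graph_cycle :: "('v \<Rightarrow> 'v \<Rightarrow> bool) \<Rightarrow> 'v list \<Rightarrow> bool" where
  "graph_cycle E xs \<longleftrightarrow>
     3 \<le> length xs \<and> distinct xs \<and> successively E xs \<and> E (last xs) (hd xs)"

definition tree_graph :: "('v \<Rightarrow> 'v \<Rightarrow> bool) \<Rightarrow> bool" where
  "tree_graph E \<longleftrightarrow> simple_graph E \<and> connected_graph E \<and> (\<nexists>xs. graph_cycle E xs)"

text \<open>For \<open>k > 0\<close> the cardinality condition also forces every neighbourhood to be finite.\<close>

definition regular_graph :: "nat \<Rightarrow> ('v \<Rightarrow> 'v \<Rightarrow> bool) \<Rightarrow> bool" where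
  "regular_graph k E \<longleftrightarrow> (\<forall>x. card {y. E x y} = k)"

text \<open>\<open>(E ^^ n) x y\<close> says that there is a walk of length \<open>n\<close> from \<open>x\<close> to \<open>y\<close>.\<close>

definition graph_dist :: "('v \<Rightarrow> 'v \<Rightarrow> bool) \<Rightarrow> 'v \<Rightarrow> 'v \<Rightarrow> nat" where
  "graph_dist E x y = (LEAST n. (E ^^ n) x y)"

definition c_fun :: "complex \<Rightarrow> complex" where
  "c_fun z = 1 / 3 * ((2 powr (1 - z) - 2 powr (z - 1)) / (2 powr (- z) - 2 powr (z - 1)))"

definition spherical :: "complex \<Rightarrow> nat \<Rightarrow> complex" where
  "spherical z n = c_fun z * 2 powr (- of_nat n * z)
     + c_fun (1 - z) * 2 powr (- of_nat n * (1 - z))"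

definition b_fun :: "real \<Rightarrow> real" where
  "b_fun lam = 8 * ((- lam\<^sup>2 + 6 * lam) / (- lam\<^sup>2 + 6 * lam - 1))"

text \<open>The operator \<open>P\<^sub>\<lambda>\<close>, written in terms of the parameter \<open>t\<close> that determines
  \<open>\<lambda> = 3 - 2 \<surd>2 cos (t log 2)\<close>.\<close>

definition P_op :: "('v \<Rightarrow> 'v \<Rightarrow> bool) \<Rightarrow> real \<Rightarrow> ('v \<Rightarrow> complex) \<Rightarrow> 'v \<Rightarrow> complex" where
  "P_op E t f x =
     (\<Sum>\<^sub>\<infinity>y. spherical (1 / 2 + \<i> * of_real t) (graph_dist E x y) * f y)"

definition l2_inner :: "('v \<Rightarrow> complex) \<Rightarrow> ('v \<Rightarrow> complex) \<Rightarrow> complex" where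
  "l2_inner f g = (\<Sum>\<^sub>\<infinity>x. f x * cnj (g x))"

definition mean_partial ::
    "('v \<Rightarrow> 'v \<Rightarrow> bool) \<Rightarrow> 'v \<Rightarrow> ('v \<Rightarrow> complex) \<Rightarrow> ('v \<Rightarrow> complex) \<Rightarrow> nat \<Rightarrow> complex" where
  "mean_partial E x0 f g N = 1 / of_nat N * (\<Sum>x | graph_dist E x x0 \<le> N. f x * cnj (g x))"

definition mean_inner ::
    "('v \<Rightarrow> 'v \<Rightarrow> bool) \<Rightarrow> 'v \<Rightarrow> ('v \<Rightarrow> complex) \<Rightarrow> ('v \<Rightarrow> complex) \<Rightarrow> complex" where
  "mean_inner E x0 f g = lim (mean_partial E x0 f g)"

end

theory Submission
  imports Defs
begin

text \<open>
  Write \<open>p = \<phi>\<^bsub>1/2+it\<^esub>\<close> and \<open>\<theta> = t log 2\<close>. The kernel of \<open>P\<^sub>\<lambda>\<close> is real and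
  symmetric, so both inner products are sums of \<open>f(y) cnj(f(w))\<close> against a kernel, and since
  the sum is finite it suffices to treat a single pair of points: for all
  \<open>x\<^sub>0, y, w\<close>, the limit of \<open>1/N\<close> times the sum of \<open>p(d(x,y)) p(d(x,w))\<close> over the ball
  of radius \<open>N\<close> around \<open>x\<^sub>0\<close> has to be \<open>(b(\<lambda>)/12) p(d(y,w))\<close>.

  When \<open>x\<^sub>0 = y\<close>, the sum over the ball can be evaluated exactly. The function
  \<open>x \<mapsto> p(d(x,w))\<close> is an eigenfunction of the adjacency operator, and such functions have a
  mean value property: their sum over the sphere of radius \<open>n\<close> around \<open>y\<close> is the value at
  \<open>y\<close> times \<open>|S\<^sub>n| p(n)\<close> (\<open>layer_sum_eigenfunction\<close>). As the other factor
  is constant on this sphere, the ball sum is \<open>p(d(y,w))\<close> times the sum of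
  \<open>|S\<^sub>n| p(n)\<^sup>2\<close> over \<open>n \<le> N\<close>.

  On the critical line \<open>p(n)\<close> is \<open>2\<^bsup>-n/2\<^esup>\<close> times a sum of two waves \<open>cis(\<plusminus>n\<theta>)\<close>, with the
  values of the c-function as coefficients. In \<open>|S\<^sub>n| p(n)\<^sup>2\<close> the decay cancels the growth of
  \<open>|S\<^sub>n| = 3/2 2\<^sup>n\<close> (for \<open>n > 0\<close>), the oscillating parts of the square average out because \<open>0 < \<theta> < \<pi>\<close>, and
  the mean tends to \<open>3 |c|\<^sup>2 = b(\<lambda>)/12\<close> (\<open>mean_square_two_wave\<close>, \<open>wave_coeff_product\<close>).

  For a general base point, the balls around \<open>x\<^sub>0\<close> and \<open>y\<close> differ only in
  \<open>O(2\<^sup>N)\<close> vertices at distance \<open>N + O(1)\<close> from \<open>y\<close> and \<open>w\<close>, where the product is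
  \<open>O(2\<^bsup>-N\<^esup>)\<close>. The change is bounded and is killed by \<open>1/N\<close>
  (\<open>ball_sum_base_change\<close>).
\<close>

section \<open>Distances in a tree\<close>

locale tree =
  fixes E :: "'v \<Rightarrow> 'v \<Rightarrow> bool"
  assumes tree: "tree_graph E"
begin

abbreviation d :: "'v \<Rightarrow> 'v \<Rightarrow> nat" where "d \<equiv> graph_dist E"

lemma edge_sym: "E x y \<Longrightarrow> E y x"
  using tree by (auto simp: tree_graph_def simple_graph_def dest: sympD)

lemma edge_irrefl: "\<not> E x x"
  using tree by (auto simp: tree_graph_def simple_graph_def dest: irreflpD)

lemma no_cycle: "\<not> graph_cycle E xs"
  using tree by (auto simp: tree_graph_def)

lemma walk_of_dist: "(E ^^ d x y) x y"
proof -
  have "E\<^sup>*\<^sup>* x y"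
    using tree by (auto simp: tree_graph_def connected_graph_def)
  then obtain n where "(E ^^ n) x y"
    by (auto simp: rtranclp_power)
  then show ?thesis
    unfolding graph_dist_def by (rule LeastI)
qed

lemma dist_le_walk: "(E ^^ n) x y \<Longrightarrow> d x y \<le> n"
  unfolding graph_dist_def by (rule Least_le)

lemma walk_sym: "(E ^^ n) x y \<Longrightarrow> (E ^^ n) y x"
proof (induction n arbitrary: y)
  case (Suc n)
  then show ?case
    by (metis edge_sym relpowp_Suc_E relpowp_Suc_I2)
qed simp

lemma dist_sym: "d x y = d y x"
  by (rule antisym; rule dist_le_walk, rule walk_sym, rule walk_of_dist)

lemma dist_triangle: "d x z \<le> d x y + d y z"
  by (rule dist_le_walk, subst relpowp_add) (use walk_of_dist in blast)

lemma dist_eq_0_iff: "d x y = 0 \<longleftrightarrow> x = y"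
proof
  show "d x y = 0 \<Longrightarrow> x = y"
    using walk_of_dist[of x y] by simp
  show "x = y \<Longrightarrow> d x y = 0"
    using dist_le_walk[of 0 x y] by simp
qed

lemma dist_edge_le: "E x u \<Longrightarrow> d u y \<le> Suc (d x y)"
  using dist_le_walk[of 1 u x] dist_triangle[of u y x] edge_sym[of x u]
  by (simp del: relpowp.simps)

lemma parent_exists:
  assumes "d x y = Suc n"
  shows "\<exists>u. E x u \<and> d u y = n"
proof -
  from walk_of_dist[of x y] obtain u where u: "E x u" "(E ^^ n) u y"
    unfolding assms by (metis relpowp_Suc_D2)
  then have "d u y \<le> n" by (intro dist_le_walk)
  moreover have "d x y \<le> Suc (d u y)" using dist_edge_le[of u x y] u edge_sym by blast
  ultimately show ?thesis using u assms by (intro exI[of _ u]) simp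
qed

text \<open>Follow geodesics from \<open>u\<close> and from \<open>v\<close> towards \<open>y\<close> until they meet. The path stays in
  the ball of radius \<open>n\<close>, so an edge between \<open>u\<close> and \<open>v\<close>, or a common neighbour outside that
  ball, would close it to a cycle. The next two lemmas exclude these two possibilities.\<close>

lemma path_inside_ball:
  assumes "d u y = n" "d v y = n" "u \<noteq> v"
  shows "\<exists>p. distinct p \<and> successively E p \<and> 3 \<le> length p \<and> hd p = u \<and> last p = v
           \<and> (\<forall>x\<in>set p. d x y \<le> n)"
  using assms
proof (induction n arbitrary: u v)
  case 0
  then show ?case by (simp add: dist_eq_0_iff)
next
  case (Suc n)
  obtain u' where u': "E u u'" "d u' y = n" using parent_exists[OF Suc.prems(1)] by blast
  obtain v' where v': "E v v'" "d v' y = n" using parent_exists[OF Suc.prems(2)] by blast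
  show ?case
  proof (cases "u' = v'")
    case True
    have "u \<noteq> u'" "u' \<noteq> v" using Suc.prems(1,2) u'(2) by (metis n_not_Suc_n)+
    moreover have "E u' v" using True v' edge_sym by blast
    ultimately show ?thesis
      using u' Suc.prems by (intro exI[of _ "[u, u', v]"]) simp
  next
    case False
    from Suc.IH[OF u'(2) v'(2) False] obtain p where
      p: "distinct p" "successively E p" "3 \<le> length p" "hd p = u'" "last p = v'"
        "\<forall>x\<in>set p. d x y \<le> n" by blast
    have "p \<noteq> []" using p by auto
    moreover have "u \<notin> set p" "v \<notin> set p"
      using p(6) Suc.prems(1,2) by (metis not_less_eq_eq order.refl)+
    moreover have "\<forall>x\<in>set p. d x y \<le> Suc n" using p(6) le_SucI by blast
    moreover have "E v' v" using v' edge_sym by blast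
    ultimately show ?thesis using p(1-5) u'(1) Suc.prems
      by (intro exI[of _ "u # p @ [v]"])
         (simp add: successively_Cons successively_append_iff)
  qed
qed

lemma dist_edge_neq:
  assumes "E u v"
  shows "d u y \<noteq> d v y"
proof
  assume "d u y = d v y"
  moreover have "u \<noteq> v" using assms edge_irrefl by blast
  ultimately obtain p where "distinct p" "successively E p" "3 \<le> length p" "hd p = u" "last p = v"
    using path_inside_ball[of u y "d v y" v] by blast
  then show False
    using no_cycle[of p] edge_sym[OF assms] by (simp add: graph_cycle_def)
qed

lemma parent_unique:
  assumes "d x y = Suc n" "E x u" "d u y = n" "E x v" "d v y = n"
  shows "u = v"
proof (rule ccontr)
  assume "u \<noteq> v"
  from path_inside_ball[OF assms(3,5) this] obtain p where p:
      "distinct p" "successively E p" "3 \<le> length p" "hd p = u"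
      "last p = v" "\<forall>z\<in>set p. d z y \<le> n"
    by blast
  have "p \<noteq> []" "x \<notin> set p" using p assms by auto
  with p assms have "graph_cycle E (x # p)"
    by (simp add: graph_cycle_def successively_Cons edge_sym[of x v])
  then show False using no_cycle by blast
qed

lemma neighbour_dist_cases:
  assumes "E x u"
  shows "d u y = Suc (d x y) \<or> d x y = Suc (d u y)"
  using dist_edge_le[OF assms, of y] dist_edge_le[OF edge_sym[OF assms], of y]
    dist_edge_neq[OF assms, of y] by linarith

end

section \<open>Mean squares of sums of two decaying waves\<close>

text \<open>The equations that make \<open>x \<mapsto> p (d x y)\<close> an eigenfunction of the adjacency operator of the
  3-regular tree, with value 1 at \<open>y\<close>: a vertex other than \<open>y\<close> has two neighbours further
  from \<open>y\<close> and one closer to \<open>y\<close>.\<close>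

definition spherical_recurrence :: "complex \<Rightarrow> (nat \<Rightarrow> complex) \<Rightarrow> bool" where
  "spherical_recurrence \<mu> p \<longleftrightarrow>
     p 0 = 1 \<and> 3 * p 1 = \<mu> \<and> (\<forall>n. 2 * p (Suc (Suc n)) + p n = \<mu> * p (Suc n))"

definition sphere_size :: "nat \<Rightarrow> nat" where
  "sphere_size n = (if n = 0 then 1 else 3 * 2 ^ (n - 1))"

lemma bounded_div_n_tendsto_0:
  fixes g :: "nat \<Rightarrow> complex"
  assumes "\<And>N. norm (g N) \<le> C"
  shows "(\<lambda>N. g N / of_nat N) \<longlonglongrightarrow> 0"
proof (rule Lim_null_comparison)
  show "\<forall>\<^sub>F N in sequentially. norm (g N / of_nat N) \<le> C / real N"
    using assms by (intro always_eventually allI) (simp add: norm_divide divide_right_mono)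
  show "(\<lambda>N. C / real N) \<longlonglongrightarrow> 0" by (rule lim_const_over_n)
qed

lemma mean_geometric_tendsto_0:
  fixes q :: complex
  assumes "q \<noteq> 1" "norm q = 1"
  shows "(\<lambda>N. (\<Sum>n\<le>N. q ^ n) / of_nat N) \<longlonglongrightarrow> 0"
proof (rule bounded_div_n_tendsto_0)
  fix N
  have "norm (1 - q ^ Suc N) \<le> 2"
    using norm_triangle_ineq4[of 1 "q ^ Suc N"] assms(2) by (simp add: norm_power norm_mult)
  moreover have "(\<Sum>n\<le>N. q ^ n) = (1 - q ^ Suc N) / (1 - q)"
    using assms(1) by (subst sum_gp0) simp
  ultimately show "norm (\<Sum>n\<le>N. q ^ n) \<le> 2 / norm (1 - q)"
    by (simp add: norm_divide divide_right_mono del: power_Suc)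
qed

text \<open>The function \<open>c\<close> as a rational function of \<open>a = 2\<^bsup>-z\<^esup>\<close> and \<open>b = 2\<^bsup>z-1\<^esup>\<close>. The
  reflection \<open>z \<mapsto> 1 - z\<close> exchanges \<open>a\<close> and \<open>b\<close>, whose product is always \<open>1/2\<close>; after this
  substitution everything about spherical functions is algebra.\<close>

definition wave_coeff :: "complex \<Rightarrow> complex \<Rightarrow> complex" where
  "wave_coeff a b = (2 * a - b) / (3 * (a - b))"

definition two_wave :: "complex \<Rightarrow> complex \<Rightarrow> nat \<Rightarrow> complex" where
  "two_wave a b n = wave_coeff a b * a ^ n + wave_coeff b a * b ^ n"

lemma spherical_eq_two_wave: "spherical z = two_wave (2 powr (- z)) (2 powr (z - 1))"
proof
  fix n
  have 1: "2 powr (1 - z) = 2 * 2 powr (- z)" "2 powr (1 - (1 - z)) = 2 * 2 powr (z - 1)"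
    by (simp_all add: powr_diff powr_minus field_simps)
  have 2: "- of_nat n * (1 - z) = of_nat n * (z - 1)" "- of_nat n * z = of_nat n * - z"
    by (simp_all add: algebra_simps)
  show "spherical z n = two_wave (2 powr (- z)) (2 powr (z - 1)) n"
    unfolding spherical_def two_wave_def c_fun_def wave_coeff_def 1 2
    by (simp add: powr_power)
qed

text \<open>\<open>a\<close> and \<open>b\<close> are the roots of \<open>2 w\<^sup>2 - \<mu> w + 1\<close> with \<open>\<mu> = 2 (a + b)\<close>, so any combination of
  their powers satisfies the recurrence; the coefficients are those that fit the two
  initial conditions.\<close>

lemma two_wave_recurrence:
  assumes "a * b = 1 / 2" "a \<noteq> b"
  shows "spherical_recurrence (2 * (a + b)) (two_wave a b)"
proof -
  have ne: "a - b \<noteq> 0" using assms by simp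
  have wave_coeff_swap: "wave_coeff b a = (a - 2 * b) / (3 * (a - b))"
    using minus_divide_divide[of "2 * b - a" "3 * (b - a)"] by (simp add: wave_coeff_def algebra_simps)
  have "wave_coeff a b + wave_coeff b a = (3 * (a - b)) / (3 * (a - b))"
    unfolding wave_coeff_swap by (simp add: wave_coeff_def add_divide_distrib[symmetric])
  then have "two_wave a b 0 = 1"
    using ne by (simp add: two_wave_def)
  moreover have "3 * two_wave a b 1 = 2 * (a + b)"
  proof -
    define e where "e = a - b"
    have "wave_coeff a b = (2 * a - b) / (3 * e)" by (simp only: wave_coeff_def e_def)
    moreover have "wave_coeff b a = (a - 2 * b) / (3 * e)" by (simp only: wave_coeff_swap e_def)
    ultimately have "3 * two_wave a b 1 = ((2 * a - b) * a + (a - 2 * b) * b) / e"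
      by (simp add: two_wave_def add_divide_distrib)
    also have "(2 * a - b) * a + (a - 2 * b) * b = 2 * (a + b) * (a - b)"
      by (simp add: algebra_simps)
    finally show ?thesis using ne by (simp add: e_def)
  qed
  moreover have "2 * two_wave a b (Suc (Suc n)) + two_wave a b n
      = 2 * (a + b) * two_wave a b (Suc n)" for n
  proof -
    have "2 * two_wave a b (Suc (Suc n)) + two_wave a b n - 2 * (a + b) * two_wave a b (Suc n)
        = (1 - 2 * (a * b)) * two_wave a b n"
      by (simp add: two_wave_def algebra_simps)
    then show ?thesis using assms(1) by simp
  qed
  ultimately show ?thesis by (simp add: spherical_recurrence_def)
qed

lemma norm_two_wave_le:
  assumes "norm a = 1 / sqrt 2" "norm b = 1 / sqrt 2"
  shows "norm (two_wave a b n) * sqrt 2 ^ n \<le> norm (wave_coeff a b) + norm (wave_coeff b a)"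
proof -
  have "norm (two_wave a b n) \<le> norm (wave_coeff a b) * (1 / sqrt 2) ^ n + norm (wave_coeff b a) * (1 / sqrt 2) ^ n"
    unfolding two_wave_def
    using norm_triangle_ineq[of "wave_coeff a b * a ^ n" "wave_coeff b a * b ^ n"] assms
    by (simp add: norm_mult norm_power)
  then show ?thesis by (simp add: field_simps)
qed

text \<open>The square of \<open>two_wave a b n\<close>, multiplied by \<open>2\<^sup>n\<close>, consists of the powers of \<open>2 a\<^sup>2\<close> and
  \<open>2 b\<^sup>2\<close>, which run around the unit circle and average to zero, and the constant cross
  term, twice the product of the two coefficients, since \<open>2 a b = 1\<close>. The sphere size
  contributes the factor \<open>3/2\<close>.\<close>

lemma mean_square_two_wave:
  assumes ab: "a * b = 1 / 2" "a \<noteq> b" and norms: "norm a = 1 / sqrt 2" "norm b = 1 / sqrt 2"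
  shows "(\<lambda>N. (\<Sum>n\<le>N. of_nat (sphere_size n) * (two_wave a b n)\<^sup>2) / of_nat N)
           \<longlonglongrightarrow> 3 * (wave_coeff a b * wave_coeff b a)"
proof -
  define q r where "q = 2 * a\<^sup>2" and "r = 2 * b\<^sup>2"
  let ?A = "wave_coeff a b" and ?B = "wave_coeff b a"
  have "a \<noteq> 0" "b \<noteq> 0" using ab(1) by auto
  have "q = 1 \<longleftrightarrow> 2 * a * (a - b) = 0" "r = 1 \<longleftrightarrow> 2 * b * (b - a) = 0"
    using ab(1) by (auto simp: q_def r_def algebra_simps power2_eq_square)
  then have "q \<noteq> 1" "r \<noteq> 1" using ab(2) \<open>a \<noteq> 0\<close> \<open>b \<noteq> 0\<close> by auto
  moreover have "norm q = 1" "norm r = 1"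
    by (simp_all add: q_def r_def norm_mult norm_power norms power_divide)
  ultimately have lim: "(\<lambda>N. (\<Sum>n\<le>N. q ^ n) / of_nat N) \<longlonglongrightarrow> 0"
      "(\<lambda>N. (\<Sum>n\<le>N. r ^ n) / of_nat N) \<longlonglongrightarrow> 0"
    by (auto intro: mean_geometric_tendsto_0)
  \<comment> \<open>The formula \<open>3/2 2\<^sup>n\<close> for the sphere size exceeds the true value by \<open>1/2\<close> at \<open>n = 0\<close>.\<close>
  have summand: "of_nat (sphere_size n) * (two_wave a b n)\<^sup>2
      = 3 / 2 * (?A\<^sup>2 * q ^ n + ?B\<^sup>2 * r ^ n + 2 * (?A * ?B))
        - (if n = 0 then (?A + ?B)\<^sup>2 / 2 else 0)" for n
  proof -
    have "2 ^ n * (two_wave a b n)\<^sup>2 = ?A\<^sup>2 * q ^ n + ?B\<^sup>2 * r ^ n + 2 * (?A * ?B) * (2 * (a * b)) ^ n"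
      unfolding two_wave_def q_def r_def
      by (simp add: power2_eq_square power_mult_distrib algebra_simps)
    also have "2 * (a * b) = 1" by (simp add: ab(1))
    finally have *: "2 ^ n * (two_wave a b n)\<^sup>2 = ?A\<^sup>2 * q ^ n + ?B\<^sup>2 * r ^ n + 2 * (?A * ?B)"
      by simp
    show ?thesis
    proof (cases n)
      case 0
      then show ?thesis by (simp add: sphere_size_def two_wave_def power2_eq_square field_simps)
    next
      case (Suc m)
      have "of_nat (sphere_size n) * (two_wave a b n)\<^sup>2 = 3 / 2 * (2 ^ n * (two_wave a b n)\<^sup>2)"
        using Suc by (simp add: sphere_size_def)
      then show ?thesis unfolding * using Suc by simp
    qed
  qed
  have total: "(\<Sum>n\<le>N. of_nat (sphere_size n) * (two_wave a b n)\<^sup>2)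
      = 3 / 2 * (?A\<^sup>2 * (\<Sum>n\<le>N. q ^ n) + ?B\<^sup>2 * (\<Sum>n\<le>N. r ^ n)) + 3 * (?A * ?B) * of_nat N
        + (3 * (?A * ?B) - (?A + ?B)\<^sup>2 / 2)" for N
    unfolding summand
    by (simp add: sum_subtractf sum.distrib sum_distrib_left sum_distrib_right sum_divide_distrib
        algebra_simps)
  let ?c = "3 * (?A * ?B) - (?A + ?B)\<^sup>2 / 2"
  have "(\<lambda>N. 3 / 2 * (?A\<^sup>2 * ((\<Sum>n\<le>N. q ^ n) / of_nat N) + ?B\<^sup>2 * ((\<Sum>n\<le>N. r ^ n) / of_nat N))
        + 3 * (?A * ?B) + ?c / of_nat N)
      \<longlonglongrightarrow> 3 / 2 * (?A\<^sup>2 * 0 + ?B\<^sup>2 * 0) + 3 * (?A * ?B) + 0"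
    by (intro tendsto_intros lim lim_const_over_n)
  moreover have "\<forall>\<^sub>F N in sequentially.
      3 / 2 * (?A\<^sup>2 * ((\<Sum>n\<le>N. q ^ n) / of_nat N) + ?B\<^sup>2 * ((\<Sum>n\<le>N. r ^ n) / of_nat N))
        + 3 * (?A * ?B) + ?c / of_nat N
      = (\<Sum>n\<le>N. of_nat (sphere_size n) * (two_wave a b n)\<^sup>2) / of_nat N"
    using eventually_gt_at_top[of 0]
    by eventually_elim (unfold total, simp add: add_divide_distrib distrib_left)
  ultimately show ?thesis by (simp add: Lim_transform_eventually)
qed

section \<open>Eigenfunctions on the 3-regular tree\<close>

locale cubic_tree = tree +
  assumes regular: "regular_graph 3 E"
begin

lemma card_neighbours: "card {u. E x u} = 3"
  using regular by (simp add: regular_graph_def)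

lemma finite_neighbours [simp]: "finite {u. E x u}"
  using card_neighbours[of x] by (intro card_ge_0_finite) simp

definition layer :: "'a \<Rightarrow> nat \<Rightarrow> 'a set" where "layer y n = {x. d x y = n}"

lemma layer_0: "layer y 0 = {y}"
  by (auto simp: layer_def dist_eq_0_iff)

lemma finite_layer [simp]: "finite (layer y n)"
proof (induction n)
  case (Suc n)
  have "layer y (Suc n) \<subseteq> (\<Union>u\<in>layer y n. {x. E u x})"
  proof
    fix x assume "x \<in> layer y (Suc n)"
    then obtain u where "E x u" "d u y = n" using parent_exists[of x y n] by (auto simp: layer_def)
    then show "x \<in> (\<Union>u\<in>layer y n. {x. E u x})" using edge_sym by (auto simp: layer_def)
  qed
  then show ?case by (rule finite_subset) (use Suc in auto)
qed (simp add: layer_0)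

definition eigenfunction :: "complex \<Rightarrow> ('a \<Rightarrow> complex) \<Rightarrow> bool" where
  "eigenfunction \<mu> h \<longleftrightarrow> (\<forall>x. (\<Sum>u | E x u. h u) = \<mu> * h x)"

lemma neighbours_Suc:
  assumes "d x y = Suc n"
  obtains u where "E x u" "d u y = n" "{v. E x v \<and> d v y = n} = {u}"
    "{v. E x v} = insert u {v. E x v \<and> d v y = Suc (Suc n)}"
    "card {v. E x v \<and> d v y = Suc (Suc n)} = 2"
proof -
  obtain u where u: "E x u" "d u y = n" using parent_exists[OF assms] by blast
  have 1: "{v. E x v \<and> d v y = n} = {u}" using parent_unique[OF assms] u by blast
  have 2: "{v. E x v} = insert u {v. E x v \<and> d v y = Suc (Suc n)}"
  proof (intro equalityI subsetI)
    fix v assume "v \<in> {v. E x v}"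
    then have "E x v" by simp
    then have "d v y = Suc (Suc n) \<or> d v y = n"
      using neighbour_dist_cases[of x v y] assms by auto
    with \<open>E x v\<close> 1 show "v \<in> insert u {v. E x v \<and> d v y = Suc (Suc n)}" by blast
  qed (use u(1) in auto)
  have "finite {v. E x v \<and> d v y = Suc (Suc n)}"
    by (rule finite_subset[OF _ finite_neighbours[of x]]) auto
  then have "Suc (card {v. E x v \<and> d v y = Suc (Suc n)}) = 3"
    using card_neighbours[of x] u(2) unfolding 2 by (subst (asm) card_insert_disjoint) auto
  then have "card {v. E x v \<and> d v y = Suc (Suc n)} = 2" by simp
  then show ?thesis by (rule that[OF u 1 2])
qed

lemma neighbours_0: "{u. E y u} = layer y 1"
proof -
  have "d u y = 1" if "E y u" for u
    using neighbour_dist_cases[OF that, of y] dist_eq_0_iff[of y y] by simp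
  moreover have "E y u" if "d u y = 1" for u
    using parent_exists[of u y 0] that edge_sym[of u y] by (auto simp: dist_eq_0_iff)
  ultimately show ?thesis by (auto simp: layer_def)
qed

lemma spherical_eigenfunction:
  assumes "spherical_recurrence \<mu> p"
  shows "eigenfunction \<mu> (\<lambda>x. p (d x y))"
  unfolding eigenfunction_def
proof
  fix x
  show "(\<Sum>u | E x u. p (d u y)) = \<mu> * p (d x y)"
  proof (cases "d x y")
    case 0
    then have "x = y" by (simp add: dist_eq_0_iff)
    moreover have "(\<Sum>u\<in>layer y 1. p (d u y)) = of_nat (card (layer y 1)) * p 1"
      by (simp add: layer_def)
    ultimately show ?thesis
      using assms card_neighbours[of y] unfolding 0
      by (simp add: neighbours_0 spherical_recurrence_def)
  next
    case (Suc n)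
    obtain u where u: "E x u" "d u y = n" "{v. E x v \<and> d v y = n} = {u}"
      "{v. E x v} = insert u {v. E x v \<and> d v y = Suc (Suc n)}"
      "card {v. E x v \<and> d v y = Suc (Suc n)} = 2" by (rule neighbours_Suc[OF Suc])
    have "finite {v. E x v \<and> d v y = Suc (Suc n)}"
      by (rule finite_subset[OF _ finite_neighbours[of x]]) auto
    moreover have "(\<Sum>v | E x v \<and> d v y = Suc (Suc n). p (d v y)) = 2 * p (Suc (Suc n))"
      using u(5) by simp
    ultimately have "(\<Sum>v | E x v. p (d v y)) = p n + 2 * p (Suc (Suc n))"
      using u(2) unfolding u(4) by (subst sum.insert) auto
    then show ?thesis using assms Suc by (simp add: spherical_recurrence_def add.commute)
  qed
qed

text \<open>Count the edges between layers from their other end. Each vertex of layer \<open>n + 2\<close> is reached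
  once, from its parent; each vertex of layer \<open>n\<close> is reached from all of its children, of
  which there are three at the centre and two elsewhere.\<close>

lemma layer_sum_neighbours:
  "(\<Sum>x\<in>layer y (Suc n). \<Sum>u | E x u. h u) =
     (\<Sum>u\<in>layer y (Suc (Suc n)). h u) + (if n = 0 then 3 else 2) * (\<Sum>u\<in>layer y n. h u :: complex)"
proof -
  let ?B = "layer y n \<union> layer y (Suc (Suc n))"
  have "(\<Sum>x\<in>layer y (Suc n). \<Sum>u | E x u. h u)
      = (\<Sum>x\<in>layer y (Suc n). \<Sum>u | u \<in> ?B \<and> E x u. h u)"
  proof (intro sum.cong refl)
    fix x assume "x \<in> layer y (Suc n)"
    then show "{u. E x u} = {u. u \<in> ?B \<and> E x u}"
      using neighbour_dist_cases[of x _ y] by (auto simp: layer_def)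
  qed
  also have "\<dots> = (\<Sum>u\<in>?B. \<Sum>x | x \<in> layer y (Suc n) \<and> E x u. h u)"
    by (rule sum.swap_restrict) auto
  also have "\<dots> = (\<Sum>u\<in>?B. of_nat (card {x. E u x \<and> d x y = Suc n}) * h u)"
  proof (rule sum.cong)
    fix u
    have "{x. x \<in> layer y (Suc n) \<and> E x u} = {x. E u x \<and> d x y = Suc n}"
      unfolding layer_def using edge_sym by blast
    then show "(\<Sum>x | x \<in> layer y (Suc n) \<and> E x u. h u)
        = of_nat (card {x. E u x \<and> d x y = Suc n}) * h u" by simp
  qed simp
  also have "\<dots> = (\<Sum>u\<in>layer y n. of_nat (card {x. E u x \<and> d x y = Suc n}) * h u)
      + (\<Sum>u\<in>layer y (Suc (Suc n)). of_nat (card {x. E u x \<and> d x y = Suc n}) * h u)"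
    by (rule sum.union_disjoint) (simp_all, auto simp: layer_def)
  also have "(\<Sum>u\<in>layer y n. of_nat (card {x. E u x \<and> d x y = Suc n}) * h u)
      = (\<Sum>u\<in>layer y n. (if n = 0 then 3 else 2) * h u)"
  proof (rule sum.cong)
    fix u assume "u \<in> layer y n"
    then have u: "d u y = n" by (simp add: layer_def)
    have "card {x. E u x \<and> d x y = Suc n} = (if n = 0 then 3 else 2)"
    proof (cases n)
      case 0
      then have "u = y" using u by (simp add: dist_eq_0_iff)
      moreover have "d x y = 1" if "E y x" for x
        using neighbours_0[of y] that by (auto simp: layer_def)
      ultimately have "{x. E u x \<and> d x y = Suc n} = {x. E u x}" using 0 by auto
      then show ?thesis using 0 card_neighbours by simp
    next
      case (Suc m)
      with u have "d u y = Suc m" by simp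
      then have "card {x. E u x \<and> d x y = Suc (Suc m)} = 2" by (rule neighbours_Suc)
      then show ?thesis using Suc by simp
    qed
    then show "of_nat (card {x. E u x \<and> d x y = Suc n}) * h u = (if n = 0 then 3 else 2) * h u"
      by simp
  qed simp
  also have "(\<Sum>u\<in>layer y (Suc (Suc n)). of_nat (card {x. E u x \<and> d x y = Suc n}) * h u)
      = (\<Sum>u\<in>layer y (Suc (Suc n)). h u)"
  proof (rule sum.cong)
    fix u assume "u \<in> layer y (Suc (Suc n))"
    then have "d u y = Suc (Suc n)" by (simp add: layer_def)
    then obtain v where "{x. E u x \<and> d x y = Suc n} = {v}" by (rule neighbours_Suc)
    then have "card {x. E u x \<and> d x y = Suc n} = 1" by simp
    then show "of_nat (card {x. E u x \<and> d x y = Suc n}) * h u = h u" by simp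
  qed simp
  finally show ?thesis by (simp add: sum_distrib_left add.commute)
qed

text \<open>The mean value property. By the preceding lemma the layer sums of an eigenfunction satisfy a
  two-step recurrence, which determines them from the value at the centre;
  \<open>|S\<^sub>n| p(n) h(y)\<close> satisfies the same recurrence.\<close>

lemma layer_sum_eigenfunction:
  assumes h: "eigenfunction \<mu> h" and p: "spherical_recurrence \<mu> p"
  shows "(\<Sum>x\<in>layer y n. h x) = of_nat (sphere_size n) * p n * h y"
proof (induction n rule: less_induct)
  case (less n)
  consider "n = 0" | "n = 1" | m where "n = Suc (Suc m)"
    by (metis One_nat_def not0_implies_Suc)
  then show ?case
  proof cases
    case 1
    then show ?thesis using p by (simp add: layer_0 sphere_size_def spherical_recurrence_def)
  next
    case 2
    have "(\<Sum>x\<in>layer y 1. h x) = \<mu> * h y"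
      using h unfolding eigenfunction_def neighbours_0[symmetric] by simp
    then show ?thesis using 2 p by (simp add: sphere_size_def spherical_recurrence_def)
  next
    case (3 m)
    have "\<mu> * (\<Sum>x\<in>layer y (Suc m). h x) =
        (\<Sum>x\<in>layer y n. h x) + (if m = 0 then 3 else 2) * (\<Sum>x\<in>layer y m. h x)"
      using layer_sum_neighbours[where h = h and y = y and n = m] h 3
      by (simp add: eigenfunction_def sum_distrib_left)
    then have "(\<Sum>x\<in>layer y n. h x) = of_nat (sphere_size (Suc m)) * (\<mu> * p (Suc m)) * h y
        - (if m = 0 then 3 else 2) * of_nat (sphere_size m) * p m * h y"
      using less[of m] less[of "Suc m"] 3 by (simp add: algebra_simps split: if_splits)
    also have "\<mu> * p (Suc m) = 2 * p n + p m"
      using p 3 by (simp add: spherical_recurrence_def)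
    also have "of_nat (sphere_size (Suc m)) * (2 * p n + p m) * h y
        - (if m = 0 then 3 else 2) * of_nat (sphere_size m) * p m * h y
        = of_nat (sphere_size n) * p n * h y"
      using 3 by (cases m) (auto simp: sphere_size_def algebra_simps)
    finally show ?thesis .
  qed
qed

text \<open>This is the mean value property of the constant function 1, which belongs to the
  eigenvalue 3.\<close>

lemma card_layer: "card (layer y n) = sphere_size n"
proof -
  have "eigenfunction 3 (\<lambda>_. 1)" by (simp add: eigenfunction_def card_neighbours)
  moreover have "spherical_recurrence 3 (\<lambda>_. 1)" by (simp add: spherical_recurrence_def)
  ultimately have "(\<Sum>x\<in>layer y n. 1) = (of_nat (sphere_size n) * 1 * 1 :: complex)"
    by (rule layer_sum_eigenfunction)
  then show ?thesis by (metis mult.right_neutral of_nat_eq_iff of_nat_1 sum_constant)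
qed

lemma ball_eq_UN_layer: "{x. d x y \<le> N} = (\<Union>n\<le>N. layer y n)"
  by (auto simp: layer_def)

lemma finite_ball [simp]: "finite {x. d x y \<le> N}"
  unfolding ball_eq_UN_layer by auto

lemma ball_sum: "(\<Sum>x | d x y \<le> N. g x) = (\<Sum>n\<le>N. \<Sum>x\<in>layer y n. g x)"
  unfolding ball_eq_UN_layer by (rule sum.UNION_disjoint) (simp_all, auto simp: layer_def)

lemma card_ball_le: "card {x. d x y \<le> N} \<le> 3 * 2 ^ N"
proof -
  have "card {x. d x y \<le> N} = (\<Sum>n\<le>N. sphere_size n)"
    using ball_sum[where g = "\<lambda>_. 1 :: nat"] by (simp add: card_layer)
  also have "\<dots> + 2 = 3 * 2 ^ N"
    by (induction N) (auto simp: sphere_size_def)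
  then have "(\<Sum>n\<le>N. sphere_size n) \<le> 3 * 2 ^ N" by linarith
  finally show ?thesis .
qed

text \<open>With the ball centred at \<open>y\<close> the factor \<open>p (d x y)\<close> is constant on each layer, and the mean
  value property applies to the other factor.\<close>

lemma ball_sum_spherical_product:
  assumes p: "spherical_recurrence \<mu> p"
  shows "(\<Sum>x | d x y \<le> N. p (d x y) * p (d x w))
       = p (d y w) * (\<Sum>n\<le>N. of_nat (sphere_size n) * (p n)\<^sup>2)"
proof -
  have "(\<Sum>x\<in>layer y n. p (d x y) * p (d x w)) = p (d y w) * (of_nat (sphere_size n) * (p n)\<^sup>2)"
    for n
  proof -
    have "(\<Sum>x\<in>layer y n. p (d x y) * p (d x w)) = p n * (\<Sum>x\<in>layer y n. p (d x w))"
      by (simp add: layer_def sum_distrib_left)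
    also have "\<dots> = p n * (of_nat (sphere_size n) * p n * p (d y w))"
      by (subst layer_sum_eigenfunction[OF spherical_eigenfunction p]) (use p in auto)
    finally show ?thesis by (simp add: power2_eq_square)
  qed
  then show ?thesis by (simp add: ball_sum sum_distrib_left)
qed

text \<open>A vertex \<open>x\<close> in one ball but not in the other has distance \<open>N\<close> from \<open>y\<close> up to
  \<open>D = d(x\<^sub>0,y)\<close>, and distance at least \<open>N - L\<close> from \<open>w\<close>, where \<open>L = D + d(y,w)\<close>. There
  are at most \<open>3 2\<^bsup>N+D\<^esup>\<close> such vertices, and the decay of \<open>p\<close> makes each term \<open>O(2\<^bsup>-N\<^esup>)\<close>, so
  the two sums differ by a bounded amount.\<close>

lemma ball_sum_base_change:
  assumes bound: "\<And>n. norm (p n) * sqrt 2 ^ n \<le> K"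
  shows "(\<lambda>N. ((\<Sum>x | d x x0 \<le> N. p (d x y) * p (d x w))
           - (\<Sum>x | d x y \<le> N. p (d x y) * p (d x w))) / of_nat N) \<longlonglongrightarrow> (0 :: complex)"
proof -
  define D where "D = d x0 y"
  define L where "L = D + d y w"
  define A where "A N = {x. d x x0 \<le> N} - {x. d x y \<le> N}" for N
  define B where "B N = {x. d x y \<le> N} - {x. d x x0 \<le> N}" for N
  let ?g = "\<lambda>x. p (d x y) * p (d x w)"
  define C where "C = 3 * 2 ^ D * (K * sqrt 2 ^ D * (K * sqrt 2 ^ L))"
  have K: "K \<ge> 0" using order.trans[OF norm_ge_zero, of "p 0" K] bound[of 0] by simp
  have scaled: "norm (p m) * sqrt 2 ^ N \<le> K * sqrt 2 ^ j" if "N \<le> m + j" for m N j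
  proof -
    have "norm (p m) * sqrt 2 ^ N \<le> norm (p m) * sqrt 2 ^ (m + j)"
      by (intro mult_left_mono power_increasing that) auto
    also have "\<dots> = (norm (p m) * sqrt 2 ^ m) * sqrt 2 ^ j" by (simp add: power_add)
    also have "\<dots> \<le> K * sqrt 2 ^ j" by (intro mult_right_mono bound) simp
    finally show ?thesis .
  qed
  have "norm ((\<Sum>x | d x x0 \<le> N. ?g x) - (\<Sum>x | d x y \<le> N. ?g x)) \<le> C" for N
  proof -
    have near: "N \<le> d x y + D \<and> d x y \<le> N + D" if "x \<in> A N \<union> B N" for x
      using that dist_triangle[of x x0 y] dist_triangle[of x y x0] dist_sym[of y x0]
      unfolding A_def B_def D_def by auto
    have g: "norm (?g x) \<le> K * sqrt 2 ^ D * (K * sqrt 2 ^ L) / 2 ^ N" if "x \<in> A N \<union> B N" for x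
    proof -
      have "N \<le> d x w + L"
        using near[OF that] dist_triangle[of x y w] dist_sym[of w y] unfolding L_def by simp
      have "norm (?g x) * 2 ^ N = (norm (p (d x y)) * sqrt 2 ^ N) * (norm (p (d x w)) * sqrt 2 ^ N)"
        by (simp add: norm_mult flip: power_mult_distrib)
      also have "\<dots> \<le> K * sqrt 2 ^ D * (K * sqrt 2 ^ L)"
        using near[OF that] \<open>N \<le> d x w + L\<close> K by (intro mult_mono scaled) auto
      finally show ?thesis by (simp add: field_simps)
    qed
    have fin: "finite (A N)" "finite (B N)" unfolding A_def B_def by auto
    have "(\<Sum>x | d x x0 \<le> N. ?g x) - (\<Sum>x | d x y \<le> N. ?g x) = sum ?g (A N) - sum ?g (B N)"
    proof -
      have "sum ?g {x. d x x0 \<le> N} = sum ?g (A N) + sum ?g ({x. d x x0 \<le> N} \<inter> {x. d x y \<le> N})"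
        unfolding A_def by (subst add.commute, rule sum.Int_Diff) simp
      moreover have "sum ?g {x. d x y \<le> N} = sum ?g (B N) + sum ?g ({x. d x x0 \<le> N} \<inter> {x. d x y \<le> N})"
        unfolding B_def by (subst add.commute, subst Int_commute, rule sum.Int_Diff) simp
      ultimately show ?thesis by simp
    qed
    then have "norm ((\<Sum>x | d x x0 \<le> N. ?g x) - (\<Sum>x | d x y \<le> N. ?g x))
        = norm (sum ?g (A N) - sum ?g (B N))" by (rule arg_cong)
    also have "\<dots> \<le> (\<Sum>x\<in>A N. norm (?g x)) + (\<Sum>x\<in>B N. norm (?g x))"
      using norm_triangle_ineq4[of "sum ?g (A N)" "sum ?g (B N)"]
        norm_sum[of ?g "A N"] norm_sum[of ?g "B N"] by linarith
    also have "\<dots> = (\<Sum>x\<in>A N \<union> B N. norm (?g x))"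
      by (rule sum.union_disjoint[symmetric]) (use fin in \<open>auto simp: A_def B_def\<close>)
    also have "\<dots> \<le> real (card (A N \<union> B N)) * (K * sqrt 2 ^ D * (K * sqrt 2 ^ L) / 2 ^ N)"
      by (rule sum_bounded_above) (rule g)
    also have "\<dots> \<le> real (3 * 2 ^ (N + D)) * (K * sqrt 2 ^ D * (K * sqrt 2 ^ L) / 2 ^ N)"
    proof (rule mult_right_mono)
      have "card (A N \<union> B N) \<le> card {x. d x y \<le> N + D}"
        by (rule card_mono) (use near in auto)
      also have "\<dots> \<le> 3 * 2 ^ (N + D)" by (rule card_ball_le)
      finally show "real (card (A N \<union> B N)) \<le> real (3 * 2 ^ (N + D))" by (rule of_nat_mono)
    qed (use K in simp)
    also have "\<dots> = C" by (simp add: C_def power_add)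
    finally show ?thesis .
  qed
  then show ?thesis by (rule bounded_div_n_tendsto_0)
qed

lemma mean_spherical_product:
  assumes p: "spherical_recurrence \<mu> p" and bound: "\<And>n. norm (p n) * sqrt 2 ^ n \<le> K"
    and lim: "(\<lambda>N. (\<Sum>n\<le>N. of_nat (sphere_size n) * (p n)\<^sup>2) / of_nat N) \<longlonglongrightarrow> m"
  shows "(\<lambda>N. (\<Sum>x | d x x0 \<le> N. p (d x y) * p (d x w)) / of_nat N) \<longlonglongrightarrow> m * p (d y w)"
proof -
  define S where "S z N = (\<Sum>x | d x z \<le> N. p (d x y) * p (d x w))" for z N
  have 1: "(\<lambda>N. (S x0 N - S y N) / of_nat N) \<longlonglongrightarrow> 0"
    unfolding S_def by (rule ball_sum_base_change[where p = p and K = K, OF bound])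
  have 2: "(\<lambda>N. S y N / of_nat N) \<longlonglongrightarrow> p (d y w) * m"
    using tendsto_mult_left[OF lim, of "p (d y w)"]
    unfolding S_def ball_sum_spherical_product[OF p] times_divide_eq_right .
  have "(\<lambda>N. (S x0 N - S y N) / of_nat N + S y N / of_nat N) \<longlonglongrightarrow> 0 + p (d y w) * m"
    using 1 2 by (rule tendsto_add)
  then have "(\<lambda>N. S x0 N / of_nat N) \<longlonglongrightarrow> m * p (d y w)"
    by (simp add: diff_divide_distrib mult.commute)
  then show ?thesis unfolding S_def .
qed

text \<open>Because \<open>p\<close> is real, \<open>Pf(x) cnj(Pf(x))\<close> expands into products \<open>p(d(x,y)) p(d(x,w))\<close>
  without conjugates. The sums over \<open>y\<close> and \<open>w\<close> are finite, so the limit may be taken term by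
  term, and the limits add up to the quadratic form of the kernel \<open>p(d(y,w))\<close> itself.\<close>

lemma mean_partial_convolution_tendsto:
  fixes S :: "'a set" and f :: "'a \<Rightarrow> complex"
  assumes p: "spherical_recurrence \<mu> p" and bound: "\<And>n. norm (p n) * sqrt 2 ^ n \<le> K"
    and lim: "(\<lambda>N. (\<Sum>n\<le>N. of_nat (sphere_size n) * (p n)\<^sup>2) / of_nat N) \<longlonglongrightarrow> m"
    and real: "\<And>n. cnj (p n) = p n"
  defines "Pf \<equiv> \<lambda>x. \<Sum>y\<in>S. p (d x y) * f y"
  shows "mean_partial E x0 Pf Pf \<longlonglongrightarrow> m * (\<Sum>x\<in>S. Pf x * cnj (f x))"
proof -
  have "mean_partial E x0 Pf Pf = (\<lambda>N. \<Sum>y\<in>S. \<Sum>w\<in>S. f y * cnj (f w) *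
      ((\<Sum>x | d x x0 \<le> N. p (d x y) * p (d x w)) / of_nat N))"
  proof
    fix N
    have "Pf x * cnj (Pf x) = (\<Sum>y\<in>S. \<Sum>w\<in>S. f y * cnj (f w) * (p (d x y) * p (d x w)))" for x
      unfolding Pf_def by (simp add: real sum_product algebra_simps)
    then have "(\<Sum>x | d x x0 \<le> N. Pf x * cnj (Pf x)) =
        (\<Sum>x | d x x0 \<le> N. \<Sum>y\<in>S. \<Sum>w\<in>S. f y * cnj (f w) * (p (d x y) * p (d x w)))"
      by simp
    also have "\<dots> = (\<Sum>y\<in>S. \<Sum>x | d x x0 \<le> N. \<Sum>w\<in>S. f y * cnj (f w) * (p (d x y) * p (d x w)))"
      by (rule sum.swap)
    also have "\<dots> = (\<Sum>y\<in>S. \<Sum>w\<in>S. \<Sum>x | d x x0 \<le> N. f y * cnj (f w) * (p (d x y) * p (d x w)))"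
      by (intro sum.cong refl sum.swap)
    finally show "mean_partial E x0 Pf Pf N = (\<Sum>y\<in>S. \<Sum>w\<in>S. f y * cnj (f w) *
      ((\<Sum>x | d x x0 \<le> N. p (d x y) * p (d x w)) / of_nat N))"
      by (simp add: mean_partial_def sum_divide_distrib sum_distrib_left)
  qed
  moreover have "(\<lambda>N. \<Sum>y\<in>S. \<Sum>w\<in>S. f y * cnj (f w) *
      ((\<Sum>x | d x x0 \<le> N. p (d x y) * p (d x w)) / of_nat N))
      \<longlonglongrightarrow> (\<Sum>y\<in>S. \<Sum>w\<in>S. f y * cnj (f w) * (m * p (d y w)))"
    by (intro tendsto_sum tendsto_mult tendsto_const mean_spherical_product[OF p bound lim])
  moreover have "(\<Sum>y\<in>S. \<Sum>w\<in>S. f y * cnj (f w) * (m * p (d y w)))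
      = m * (\<Sum>x\<in>S. Pf x * cnj (f x))"
  proof -
    have "(\<Sum>y\<in>S. \<Sum>w\<in>S. f y * cnj (f w) * (m * p (d y w)))
        = (\<Sum>w\<in>S. \<Sum>y\<in>S. f y * cnj (f w) * (m * p (d w y)))"
      by (subst sum.swap) (simp add: dist_sym)
    then show ?thesis
      by (simp add: Pf_def sum_distrib_left sum_distrib_right algebra_simps)
  qed
  ultimately show ?thesis by simp
qed

end

section \<open>The spherical functions on the critical line\<close>

lemma P_op_finite_support:
  assumes "finite {x. f x \<noteq> 0}"
  shows "P_op E t f x
    = (\<Sum>y | f y \<noteq> 0. spherical (1 / 2 + \<i> * of_real t) (graph_dist E x y) * f y)"
  unfolding P_op_def by (subst infsum_finite[OF assms, symmetric], rule infsum_cong_neutral) simp_all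

lemma l2_inner_finite_support:
  assumes "finite {x. g x \<noteq> 0}"
  shows "l2_inner f g = (\<Sum>x | g x \<noteq> 0. f x * cnj (g x))"
  unfolding l2_inner_def by (subst infsum_finite[OF assms, symmetric], rule infsum_cong_neutral) simp_all

lemma two_powr_critical_line:
  "(2 :: complex) powr (- (1 / 2 + \<i> * of_real t)) = of_real (1 / sqrt 2) * cis (- (t * ln 2))"
  "(2 :: complex) powr ((1 / 2 + \<i> * of_real t) - 1) = of_real (1 / sqrt 2) * cis (t * ln 2)"
proof -
  have half: "(2 :: complex) powr (- 1 / 2) = of_real (1 / sqrt 2)"
  proof -
    have "(2 :: complex) powr (- 1 / 2) = of_real (2 powr (- 1 / 2))"
      using powr_of_real[of 2 "- 1 / 2"] by simp
    also have "(2 :: real) powr (- 1 / 2) = 1 / sqrt 2"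
      using powr_minus_divide[of "2 :: real" "1 / 2"] by (simp add: powr_half_sqrt)
    finally show ?thesis .
  qed
  have osc: "(2 :: complex) powr (\<i> * of_real s) = cis (s * ln 2)" for s
    using Ln_of_real[of 2] by (simp add: powr_def cis_conv_exp algebra_simps)
  have "(2 :: complex) powr (- (1 / 2 + \<i> * of_real t)) = 2 powr (- 1 / 2) * 2 powr (\<i> * of_real (- t))"
    by (subst powr_add[symmetric]) simp
  then show "(2 :: complex) powr (- (1 / 2 + \<i> * of_real t)) = of_real (1 / sqrt 2) * cis (- (t * ln 2))"
    unfolding half osc by simp
  have "(2 :: complex) powr ((1 / 2 + \<i> * of_real t) - 1) = 2 powr (- 1 / 2) * 2 powr (\<i> * of_real t)"
    by (subst powr_add[symmetric]) (simp add: algebra_simps)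
  then show "(2 :: complex) powr ((1 / 2 + \<i> * of_real t) - 1) = of_real (1 / sqrt 2) * cis (t * ln 2)"
    unfolding half osc by simp
qed

lemma b_fun_eq:
  assumes "sin \<theta> \<noteq> 0"
  shows "b_fun (3 - 2 * sqrt 2 * cos \<theta>) = 8 + 1 / (sin \<theta>)\<^sup>2"
proof -
  define lam where "lam = 3 - 2 * sqrt 2 * cos \<theta>"
  have "- lam\<^sup>2 + 6 * lam = 9 - 8 * (cos \<theta>)\<^sup>2"
    by (simp add: lam_def power2_eq_square algebra_simps)
  then have "- lam\<^sup>2 + 6 * lam = 1 + 8 * (sin \<theta>)\<^sup>2"
    by (simp add: cos_squared_eq)
  then have "b_fun lam = 8 * ((1 + 8 * (sin \<theta>)\<^sup>2) / (8 * (sin \<theta>)\<^sup>2))"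
    by (simp add: b_fun_def)
  then show ?thesis
    using assms unfolding lam_def[symmetric] by (simp add: field_simps)
qed

text \<open>The product is \<open>|c(1/2 + it)|\<^sup>2\<close>, so by \<open>b_fun_eq\<close> this says \<open>b(\<lambda>) = 36 |c(1/2 + it)|\<^sup>2\<close>, which
  explains the constant \<open>12\<close>: the mean square is \<open>3 |c|\<^sup>2\<close>.\<close>

lemma wave_coeff_product:
  assumes "sin \<theta> \<noteq> 0"
  defines "a \<equiv> of_real (1 / sqrt 2) * cis (- \<theta>)" and "b \<equiv> of_real (1 / sqrt 2) * cis \<theta>"
  shows "wave_coeff a b * wave_coeff b a = of_real ((8 + 1 / (sin \<theta>)\<^sup>2) / 36)"
proof -
  have ab: "a * b = 1 / 2"
    by (simp add: a_def b_def complex_eq_iff cis_mult flip: power2_eq_square)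
  have "a - b = - \<i> * of_real (sqrt 2 * sin \<theta>)"
    by (simp add: a_def b_def complex_eq_iff field_simps)
  then have diff: "(a - b)\<^sup>2 = - of_real (2 * (sin \<theta>)\<^sup>2)"
    by (simp add: power_mult_distrib flip: of_real_power)
  have "a \<noteq> b" using diff assms(1) by auto
  then have "wave_coeff a b * wave_coeff b a = - ((2 * a - b) * (2 * b - a)) / (9 * (a - b)\<^sup>2)"
    by (simp add: wave_coeff_def divide_simps power2_eq_square) (simp add: algebra_simps)
  also have "(2 * a - b) * (2 * b - a) = a * b - 2 * (a - b)\<^sup>2"
    by (simp add: power2_eq_square algebra_simps)
  also have "- (a * b - 2 * (a - b)\<^sup>2) / (9 * (a - b)\<^sup>2) = of_real ((8 + 1 / (sin \<theta>)\<^sup>2) / 36)"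
    unfolding diff ab using assms(1) by (simp add: field_simps)
  finally show ?thesis .
qed

theorem theorem4p18:
  fixes E :: "'v \<Rightarrow> 'v \<Rightarrow> bool" and lam t :: real and f :: "'v \<Rightarrow> complex"
  assumes "tree_graph E" and "regular_graph 3 E"
    and "lam \<in> interior {3 - 2 * sqrt 2 .. 3 + 2 * sqrt 2}"
    and "0 < t" and "t < pi / ln 2"
    and "lam = 3 - 2 * sqrt 2 * cos (t * ln 2)"
    and "finite {x. f x \<noteq> 0}"
  shows "(\<forall>x0. convergent (mean_partial E x0 (P_op E t f) (P_op E t f)))
    \<and> (\<forall>x0 x1. mean_inner E x0 (P_op E t f) (P_op E t f)
                = mean_inner E x1 (P_op E t f) (P_op E t f))
    \<and> (\<forall>x0. l2_inner (P_op E t f) f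
          = 12 * inverse (complex_of_real (b_fun lam))
              * mean_inner E x0 (P_op E t f) (P_op E t f))"
proof -
  interpret cubic_tree E by unfold_locales (rule assms(1), rule assms(2))
  define \<theta> where "\<theta> = t * ln 2"
  have "0 < \<theta>" "\<theta> < pi" using assms(4,5) by (simp_all add: \<theta>_def field_simps)
  then have sin: "sin \<theta> > 0" by (rule sin_gt_zero)
  have b: "b_fun lam = 8 + 1 / (sin \<theta>)\<^sup>2"
    using b_fun_eq[of \<theta>] sin assms(6) by (simp add: \<theta>_def)
  then have b_pos: "b_fun lam > 0" using sin by (simp add: add_pos_pos)
  define a where "a = of_real (1 / sqrt 2) * cis (- \<theta>)"
  define c where "c = of_real (1 / sqrt 2) * cis \<theta>"
  define p where "p = spherical (1 / 2 + \<i> * of_real t)"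
  have p_wave: "p = two_wave a c"
    unfolding p_def a_def c_def \<theta>_def by (simp only: spherical_eq_two_wave two_powr_critical_line)
  have "a * c = 1 / 2"
    by (simp add: a_def c_def complex_eq_iff cis_mult flip: power2_eq_square)
  moreover have "a \<noteq> c" using sin by (auto simp: a_def c_def complex_eq_iff)
  moreover have norms: "norm a = 1 / sqrt 2" "norm c = 1 / sqrt 2"
    by (auto simp: a_def c_def norm_mult norm_divide)
  ultimately have lim: "(\<lambda>N. (\<Sum>n\<le>N. of_nat (sphere_size n) * (p n)\<^sup>2) / of_nat N)
      \<longlonglongrightarrow> 3 * (wave_coeff a c * wave_coeff c a)"
    unfolding p_wave by (rule mean_square_two_wave)
  have rec: "spherical_recurrence (2 * (a + c)) p"
    unfolding p_wave using \<open>a * c = 1 / 2\<close> \<open>a \<noteq> c\<close> by (rule two_wave_recurrence)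
  have coeffs: "wave_coeff a c * wave_coeff c a = of_real (b_fun lam / 36)"
    unfolding a_def c_def b by (rule wave_coeff_product) (use sin in simp)
  have m: "3 * (wave_coeff a c * wave_coeff c a) = of_real (b_fun lam) / 12"
    unfolding coeffs by simp
  \<comment> \<open>Conjugation exchanges the two waves together with their coefficients.\<close>
  have "cnj a = c" "cnj c = a" by (simp_all add: a_def c_def cis_cnj)
  then have real: "cnj (p n) = p n" for n
    by (simp add: p_wave two_wave_def wave_coeff_def add.commute)
  let ?S = "{x. f x \<noteq> 0}"
  have Pf: "P_op E t f = (\<lambda>x. \<Sum>y\<in>?S. p (d x y) * f y)"
    unfolding p_def by (rule ext) (rule P_op_finite_support[OF assms(7)])
  have key: "mean_partial E x0 (P_op E t f) (P_op E t f)
      \<longlonglongrightarrow> of_real (b_fun lam) / 12 * l2_inner (P_op E t f) f" for x0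
    unfolding l2_inner_finite_support[OF assms(7)] Pf m[symmetric]
    by (rule mean_partial_convolution_tendsto[OF rec _ lim real])
       (unfold p_wave, rule norm_two_wave_le[OF norms])
  then have mean: "mean_inner E x0 (P_op E t f) (P_op E t f)
      = of_real (b_fun lam) / 12 * l2_inner (P_op E t f) f" for x0
    unfolding mean_inner_def by (rule limI)
  have "convergent (mean_partial E x0 (P_op E t f) (P_op E t f))" for x0
    using key by (rule convergentI)
  moreover have "mean_inner E x0 (P_op E t f) (P_op E t f)
      = mean_inner E x1 (P_op E t f) (P_op E t f)" for x0 x1
    unfolding mean ..
  moreover have "l2_inner (P_op E t f) f = 12 * inverse (complex_of_real (b_fun lam))
      * mean_inner E x0 (P_op E t f) (P_op E t f)" for x0
    unfolding mean using b_pos by simp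
  ultimately show ?thesis by blast
qed

end
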